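(* For all integers $\ell\ge 1$ and $m\ge \ell+1$, $$d_\ell^2(m)>d_\ell(m-1)\,d_\ell(m+1)>d_{\ell-1}(m)\,d_{\ell+1}(m).$$
   Context: For integers $0\le \ell\le m$, the Boros-Moll numbers are $$d_\ell(m)=2^{-2m}\sum_{k=\ell}^m 2^k \binom{2m-2k}{m-k}\binom{m+k}{k}\binom{k}{\ell},$$ and $d_\ell^2(m)$ denotes $(d_\ell(m))^2$. *)

theory Defs
  imports Complex_Main
begin

(* For l > m the index set is empty and the value is 0; the intended range is l \<le> m. *)
definition boros_moll :: "nat \<Rightarrow> nat \<Rightarrow> real" where
  "boros_moll l m =
     (\<Sum>k = l..m. 2 ^ k * real ((2 * m - 2 * k) choose (m - k))
        * real ((m + k) choose k) * real (k choose l)) / 2 ^ (2 * m)"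

end

theory Submission
  imports Defs
begin

text \<open>
  Write \<open>d l m\<close> for the Boros-Moll numbers. The coefficients of the Boros-Moll polynomial in
  powers of \<open>x + 1\<close> are hypergeometric, which gives two contiguous relations: one linear relation
  between \<open>d l (m + 1)\<close>, \<open>d (l - 1) m\<close>, \<open>d l m\<close>, and one three-term relation in \<open>l\<close>. They imply
  a three-term relation in \<open>m\<close>, from which induction on \<open>m\<close> yields the Kauers-Paule bound
  \<open>2 (m + 1) (m + 1 - l) d l (m + 1) \<ge> (4 m\<^sup>2 + 7 m + l + 3) d l m\<close>.
  With \<open>2 (m + 1) (m + 1 - l) d l (m + 1) = U d l m\<close>, the relations express the three products in
  the theorem as \<open>(d l m)\<^sup>2\<close> times quadratic polynomials in \<open>U\<close>, and both inequalities follow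
  for all \<open>U\<close> above the Kauers-Paule bound.
\<close>

section \<open>Coefficients in powers of \<open>x + 1\<close> and their recurrences\<close>

text \<open>The explicit zero for \<open>k > m\<close> matters: truncated subtraction would turn the
  central binomial coefficient into 1 there, and index shifts in sums over \<open>k\<close> would
  leave boundary terms.\<close>

definition bm_coeff :: "nat \<Rightarrow> nat \<Rightarrow> real" where
  "bm_coeff m k = (if k \<le> m then 2 ^ k * real ((2 * (m - k)) choose (m - k))
     * real ((m + k) choose k) / 4 ^ m else 0)"

lemma boros_moll_eq_sum:
  assumes "m \<le> N"
  shows "boros_moll l m = (\<Sum>k\<le>N. bm_coeff m k * real (k choose l))"
proof -
  have "(\<Sum>k\<le>N. bm_coeff m k * real (k choose l)) = (\<Sum>k=l..m. bm_coeff m k * real (k choose l))"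
    by (rule sum.mono_neutral_right) (use assms in \<open>auto simp: bm_coeff_def\<close>)
  also have "\<dots> = boros_moll l m"
    unfolding boros_moll_def sum_divide_distrib
    by (rule sum.cong) (auto simp: bm_coeff_def power_mult diff_mult_distrib2)
  finally show ?thesis by simp
qed

lemma central_binomial_Suc:
  "real (Suc n) * real ((2 * Suc n) choose Suc n) = 2 * (2 * real n + 1) * real ((2 * n) choose n)"
proof -
  have 1: "Suc n * (Suc (Suc (2 * n)) choose Suc n) = Suc (Suc (2 * n)) * (Suc (2 * n) choose n)"
    by (rule Suc_times_binomial)
  have 2: "Suc n * (Suc (2 * n) choose n) = Suc (2 * n) * (2 * n choose n)"
    using binomial_symmetric[of n "Suc (2 * n)"] Suc_times_binomial[of n "2 * n"]
    by (simp add: Suc_diff_le)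
  have "Suc n * (Suc n * ((2 * Suc n) choose Suc n)) = 2 * Suc n * (Suc n * (Suc (2 * n) choose n))"
    using 1 by (metis (no_types, lifting) mult.left_commute mult_2 add_Suc add_Suc_right mult.assoc)
  also have "\<dots> = Suc n * (2 * (2 * n + 1) * (2 * n choose n))"
    unfolding 2 by simp
  finally have "Suc n * ((2 * Suc n) choose Suc n) = 2 * (2 * n + 1) * (2 * n choose n)"
    by (simp only: mult_cancel1) simp
  then have "real (Suc n * ((2 * Suc n) choose Suc n)) = real (2 * (2 * n + 1) * (2 * n choose n))"
    by (rule arg_cong)
  then show ?thesis by (simp only: of_nat_mult of_nat_add of_nat_numeral of_nat_1)
qed

lemma real_Suc_times_binomial:
  "real (k + 1) * real ((n + k + 1) choose (k + 1)) = real (n + k + 1) * real ((n + k) choose k)"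
  using arg_cong[OF Suc_times_binomial[of k "n + k"], of real] by (simp only: of_nat_mult) simp

text \<open>Trades a factor \<open>k\<close> for a shift of the lower binomial index, so that
  factors polynomial in \<open>k\<close> can be removed from sums against
  \<open>k choose j\<close>.\<close>

lemma real_binomial_absorb:
  "real k * real (k choose j) = real j * real (k choose j) + real (j + 1) * real (k choose (j + 1))"
proof (cases "j \<le> k")
  case True
  have "(j + 1) * (k choose (j + 1)) = (k - j) * (k choose j)"
    using binomial_absorb_comp[of k j] binomial_absorption[of j k] by simp
  then have "real (j + 1) * real (k choose (j + 1)) = (real k - real j) * real (k choose j)"
    using True by (metis of_nat_diff of_nat_mult)
  then show ?thesis by (simp add: algebra_simps)
qed (simp add: binomial_eq_0)

text \<open>Only the power of 2 and the two binomials depend on \<open>k\<close>, and each has a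
  rational ratio of consecutive values. For \<open>k = m\<close> both sides vanish, the left by the
  zero extension and the right by the factor \<open>m - k\<close>.\<close>

lemma bm_coeff_Suc_right:
  "real (k + 1) * (2 * real m - 2 * real k - 1) * bm_coeff m (k + 1)
     = (real m - real k) * (real m + real k + 1) * bm_coeff m k"
proof (cases "k < m")
  case True
  then obtain n where m: "m = k + n + 1"
    using less_iff_Suc_add by auto
  define X Y where "X = real ((2 * n) choose n)" and "Y = real ((m + k) choose k)"
  have X: "(real n + 1) * real ((2 * (n + 1)) choose (n + 1)) = 2 * (2 * real n + 1) * X"
    using central_binomial_Suc[of n] by (simp add: X_def add.commute)
  have Y: "(real k + 1) * real ((m + k + 1) choose (k + 1)) = (real m + real k + 1) * Y"
    using real_Suc_times_binomial[of k m] by (simp add: Y_def add_ac)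
  have "real (k + 1) * (2 * real m - 2 * real k - 1) * bm_coeff m (k + 1)
      = 2 ^ (k + 1) / 4 ^ m * ((2 * real n + 1) * X)
        * ((real k + 1) * real ((m + k + 1) choose (k + 1)))"
    by (simp add: bm_coeff_def m X_def) (simp add: algebra_simps)
  also have "\<dots> = 2 ^ k / 4 ^ m * ((real n + 1) * real ((2 * (n + 1)) choose (n + 1)))
        * ((real m + real k + 1) * Y)"
    unfolding X Y by simp
  also have "\<dots> = (real m - real k) * (real m + real k + 1) * bm_coeff m k"
    by (simp add: bm_coeff_def m Y_def)
  finally show ?thesis .
qed (auto simp: bm_coeff_def)

text \<open>The diagonal shift fixes \<open>m - k\<close>, hence the central binomial; the other
  binomial changes by two absorption steps.\<close>

lemma bm_coeff_Suc_Suc: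
  "2 * (real m + 1) * real (k + 1) * bm_coeff (m + 1) (k + 1)
     = (real m + real k + 1) * (real m + real k + 2) * bm_coeff m k"
proof (cases "k \<le> m")
  case True
  define Y where "Y = real ((m + k) choose k)"
  define Z where "Z = real ((m + k + 1) choose (k + 1))"
  define W where "W = real ((m + k + 2) choose (k + 1))"
  have Y: "(real k + 1) * Z = (real m + real k + 1) * Y"
    using real_Suc_times_binomial[of k m] by (simp add: Y_def Z_def add_ac)
  have "(m + 1) * ((m + k + 2) choose (k + 1)) = (m + k + 2) * ((m + k + 1) choose (k + 1))"
    using binomial_absorb_comp[of "m + k + 2" "k + 1"] by simp
  then have W: "(real m + 1) * W = (real m + real k + 2) * Z"
    unfolding W_def Z_def
    by (metis (no_types, opaque_lifting) of_nat_1 of_nat_add of_nat_mult of_nat_numeral)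
  have "bm_coeff (m + 1) (k + 1)
      = 2 ^ (k + 1) / 4 ^ (m + 1) * real ((2 * (m - k)) choose (m - k)) * W"
    using True by (simp add: bm_coeff_def W_def del: binomial_Suc_Suc)
  then have "2 * (real m + 1) * real (k + 1) * bm_coeff (m + 1) (k + 1)
      = 2 ^ k / 4 ^ m * real ((2 * (m - k)) choose (m - k)) * ((real k + 1) * ((real m + 1) * W))"
    by (simp add: field_simps)
  also have "(real k + 1) * ((real m + 1) * W) = (real m + real k + 2) * ((real m + real k + 1) * Y)"
    unfolding W Y[symmetric] by simp
  also have "2 ^ k / 4 ^ m * real ((2 * (m - k)) choose (m - k)) * \<dots>
      = (real m + real k + 1) * (real m + real k + 2) * bm_coeff m k"
    using True by (simp add: bm_coeff_def Y_def)
  finally show ?thesis .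
qed (simp add: bm_coeff_def)

text \<open>Splitting \<open>m + k + 2 = 2 * (k + 1) + (m - k)\<close> in the diagonal relation and
  trading the part with \<open>m - k\<close> for \<open>bm_coeff m (k + 1)\<close> makes
  \<open>k + 1\<close> a common factor. The result has no denominator in \<open>k\<close>, so it can
  be summed.\<close>

lemma bm_coeff_Suc_left:
  "(real m + 1) * bm_coeff (m + 1) (k + 1)
     = (real m + real k + 1) * bm_coeff m k + (real m - real k - 1 / 2) * bm_coeff m (k + 1)"
proof -
  have "2 * real (k + 1) * ((real m + 1) * bm_coeff (m + 1) (k + 1))
     = 2 * real (k + 1) * ((real m + real k + 1) * bm_coeff m k)
       + real (k + 1) * (2 * real m - 2 * real k - 1) * bm_coeff m (k + 1)"
    using bm_coeff_Suc_Suc[of m k] unfolding bm_coeff_Suc_right by (simp add: algebra_simps)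
  also have "\<dots> = 2 * real (k + 1) *
      ((real m + real k + 1) * bm_coeff m k + (real m - real k - 1 / 2) * bm_coeff m (k + 1))"
    by (simp add: algebra_simps)
  finally show ?thesis by (simp del: of_nat_add)
qed

section \<open>Contiguous relations for the Boros-Moll numbers\<close>

text \<open>The preceding coefficient relation is summed against
  \<open>(k + 1) choose (j + 1)\<close>; Pascal's rule and absorption remove
  \<open>k\<close>.\<close>

lemma boros_moll_Suc_left:
  "(real m + 1) * boros_moll (j + 1) (m + 1)
     = (real m + real j + 1) * boros_moll j m
       + (4 * real m + 2 * real j + 5) / 2 * boros_moll (j + 1) m"
proof -
  let ?c = "bm_coeff m"
  \<comment> \<open>Chosen so that \<open>h (Suc k)\<close> is the second summand below. Since
    \<open>h 0\<close> and \<open>h (Suc m)\<close> vanish, the shift of index leaves no boundary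
    terms.\<close>
  define h where "h k = (real m - real k + 1 / 2) * ?c k * real (k choose (j + 1))" for k
  have "(real m + 1) * boros_moll (j + 1) (m + 1)
      = (\<Sum>k\<le>m. (real m + 1) * bm_coeff (m + 1) (k + 1) * real ((k + 1) choose (j + 1)))"
    by (simp add: boros_moll_eq_sum[OF order.refl] sum.atMost_Suc_shift sum_distrib_left mult.assoc
        del: sum.atMost_Suc binomial_Suc_Suc)
  also have "\<dots> = (\<Sum>k\<le>m. (real m + real k + 1) * ?c k * real ((k + 1) choose (j + 1)) + h (Suc k))"
    unfolding bm_coeff_Suc_left by (simp add: h_def algebra_simps)
  also have "\<dots> = (\<Sum>k\<le>m. (real m + real k + 1) * ?c k * real ((k + 1) choose (j + 1)))
      + (\<Sum>k\<le>Suc m. h k)"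
    unfolding sum.atMost_Suc_shift by (simp add: sum.distrib h_def)
  also have "(\<Sum>k\<le>Suc m. h k) = (\<Sum>k\<le>m. h k)"
    by (simp add: h_def bm_coeff_def)
  also have "(\<Sum>k\<le>m. (real m + real k + 1) * ?c k * real ((k + 1) choose (j + 1))) + (\<Sum>k\<le>m. h k)
      = (\<Sum>k\<le>m. (real m + real j + 1) * (?c k * real (k choose j))
          + (4 * real m + 2 * real j + 5) / 2 * (?c k * real (k choose (j + 1))))"
    unfolding sum.distrib[symmetric]
  proof (rule sum.cong[OF refl])
    fix k
    have "(real m + real k + 1) * ?c k * real ((k + 1) choose (j + 1)) + h k
       = ?c k * ((real m + 1) * real (k choose j) + real k * real (k choose j)
           + (2 * real m + 3 / 2) * real (k choose (j + 1)))"
      by (simp add: h_def algebra_simps)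
    also have "\<dots> = (real m + real j + 1) * (?c k * real (k choose j))
          + (4 * real m + 2 * real j + 5) / 2 * (?c k * real (k choose (j + 1)))"
      unfolding real_binomial_absorb by (simp add: field_simps)
    finally show "(real m + real k + 1) * ?c k * real ((k + 1) choose (j + 1)) + h k = \<dots>" .
  qed
  also have "\<dots> = (real m + real j + 1) * boros_moll j m
       + (4 * real m + 2 * real j + 5) / 2 * boros_moll (j + 1) m"
    by (simp add: boros_moll_eq_sum[OF order.refl] sum.distrib sum_distrib_left)
  finally show ?thesis .
qed

text \<open>The recurrence of the coefficients in \<open>k\<close> is summed against
  \<open>k choose j\<close>; after a shift of index, absorption applied twice expresses everything
  through the lower indices \<open>j\<close>, \<open>j + 1\<close>, \<open>j + 2\<close>.\<close>

lemma boros_moll_three_term_index: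
  "(real m - real j) * (real m + real j + 1) * boros_moll j m
     - (real j + 1) * (2 * real m + 1) * boros_moll (j + 1) m
     + (real j + 1) * (real j + 2) * boros_moll (j + 2) m = 0"
proof -
  let ?c = "bm_coeff m"
  \<comment> \<open>The factor \<open>k\<close> removes the term at 0, where \<open>k - 1\<close> is
    truncated, and the zero extension removes the term at \<open>Suc m\<close>.\<close>
  define h where "h k = real k * (2 * real m - 2 * real k + 1) * ?c k * real ((k - 1) choose j)" for k
  have "(\<Sum>k\<le>m. (real m - real k) * (real m + real k + 1) * ?c k * real (k choose j))
      = (\<Sum>k\<le>m. h (Suc k))"
    unfolding bm_coeff_Suc_right[symmetric] by (simp add: h_def algebra_simps)
  also have "\<dots> = (\<Sum>k\<le>Suc m. h k)"
    unfolding sum.atMost_Suc_shift by (simp add: h_def)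
  also have "\<dots> = (\<Sum>k\<le>m. h k)"
    by (simp add: h_def bm_coeff_def)
  finally have "0 = (\<Sum>k\<le>m. (real m - real k) * (real m + real k + 1) * ?c k * real (k choose j) - h k)"
    by (simp add: sum_subtractf)
  also have "\<dots> = (\<Sum>k\<le>m. (real m - real j) * (real m + real j + 1) * (?c k * real (k choose j))
     - (real j + 1) * (2 * real m + 1) * (?c k * real (k choose (j + 1)))
     + (real j + 1) * (real j + 2) * (?c k * real (k choose (j + 2))))"
  proof (rule sum.cong[OF refl])
    fix k
    define X Y Z where "X = real (k choose j)" and "Y = real (k choose (j + 1))"
      and "Z = real (k choose (j + 2))"
    have X: "real k * X = real j * X + (real j + 1) * Y"
      using real_binomial_absorb[of k j] by (simp add: X_def Y_def add_ac)
    have Y: "real k * Y = (real j + 1) * Y + (real j + 2) * Z"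
      using real_binomial_absorb[of k "j + 1"] by (simp add: Y_def Z_def add_ac)
    have "real k * real ((k - 1) choose j) = (real j + 1) * Y"
      using real_Suc_times_binomial[of j "k - 1 - j"] binomial_absorption[of j k]
      by (metis Y_def add.commute of_nat_Suc of_nat_mult Suc_eq_plus1)
    then have h: "h k = (2 * real m - 2 * real k + 1) * ?c k * ((real j + 1) * Y)"
      unfolding h_def by algebra
    have "(real m - real k) * (real m + real k + 1) * X - (2 * real m - 2 * real k + 1) * ((real j + 1) * Y)
      = (real m - real j) * (real m + real j + 1) * X - (real j + 1) * (2 * real m + 1) * Y
        + (real j + 1) * (real j + 2) * Z"
      using X Y by algebra
    then have "?c k * ((real m - real k) * (real m + real k + 1) * X
        - (2 * real m - 2 * real k + 1) * ((real j + 1) * Y))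
      = ?c k * ((real m - real j) * (real m + real j + 1) * X - (real j + 1) * (2 * real m + 1) * Y
        + (real j + 1) * (real j + 2) * Z)" by simp
    then show "(real m - real k) * (real m + real k + 1) * ?c k * real (k choose j) - h k
      = (real m - real j) * (real m + real j + 1) * (?c k * real (k choose j))
     - (real j + 1) * (2 * real m + 1) * (?c k * real (k choose (j + 1)))
     + (real j + 1) * (real j + 2) * (?c k * real (k choose (j + 2)))"
      unfolding h X_def[symmetric] Y_def[symmetric] Z_def[symmetric] by (simp add: algebra_simps)
  qed
  also have "\<dots> = (real m - real j) * (real m + real j + 1) * boros_moll j m
     - (real j + 1) * (2 * real m + 1) * boros_moll (j + 1) m
     + (real j + 1) * (real j + 2) * boros_moll (j + 2) m"
    by (simp add: boros_moll_eq_sum[OF order.refl] sum.distrib sum_subtractf sum_distrib_left)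
  finally show ?thesis by simp
qed

context
  fixes l m :: nat
  assumes l_pos: "l \<ge> 1"
begin

lemma boros_moll_lower_index:
  "2 * (real m + real l) * boros_moll (l - 1) m
     = 2 * (real m + 1) * boros_moll l (m + 1) - (4 * real m + 2 * real l + 3) * boros_moll l m"
proof -
  obtain j where "l = j + 1" using l_pos by (metis add.commute le_Suc_ex)
  then show ?thesis
    using boros_moll_Suc_left[of m j] by (simp add: field_simps)
qed

text \<open>Eliminates \<open>boros_moll (l - 1) m\<close> between the three-term relation in the
  index and the lower-index relation.\<close>

lemma boros_moll_upper_index:
  "2 * real l * (real l + 1) * boros_moll (l + 1) m
     = (4 * real m - 2 * real l + 3) * (real m + real l + 1) * boros_moll l m
       - 2 * (real m + 1) * (real m + 1 - real l) * boros_moll l (m + 1)"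
proof -
  obtain j where l: "l = j + 1" using l_pos by (metis add.commute le_Suc_ex)
  have "(real m + 1 - real l) * (real m + real l) * boros_moll (l - 1) m
     - real l * (2 * real m + 1) * boros_moll l m + real l * (real l + 1) * boros_moll (l + 1) m = 0"
    using boros_moll_three_term_index[of m j] by (simp add: l algebra_simps)
  with boros_moll_lower_index show ?thesis by algebra
qed

end

text \<open>The upper-index relation at \<open>m\<close> and at \<open>m + 1\<close> eliminates both
  numbers of index \<open>l + 1\<close> from the linear relation between them.\<close>

lemma boros_moll_three_term:
  assumes "l \<ge> 1"
  shows "4 * (real m + 2 - real l) * (real m + 1) * (real m + 2) * boros_moll l (m + 2)
     = 2 * (real m + 1) * (8 * (real m)\<^sup>2 + 24 * real m + 19 - 4 * (real l)\<^sup>2) * boros_moll l (m + 1)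
       - (real m + real l + 1) * (4 * real m + 3) * (4 * real m + 5) * boros_moll l m"
proof -
  define a b c e f where "a = boros_moll l m" and "b = boros_moll l (m + 1)"
    and "c = boros_moll l (m + 2)" and "e = boros_moll (l + 1) m" and "f = boros_moll (l + 1) (m + 1)"
  have 1: "2 * real l * (real l + 1) * e = (4 * real m - 2 * real l + 3) * (real m + real l + 1) * a
       - 2 * (real m + 1) * (real m + 1 - real l) * b"
    using boros_moll_upper_index[OF assms, of m] by (simp add: a_def b_def e_def)
  have 2: "2 * real l * (real l + 1) * f = (4 * real m - 2 * real l + 7) * (real m + real l + 2) * b
       - 2 * (real m + 2) * (real m + 2 - real l) * c"
    using boros_moll_upper_index[OF assms, of "m + 1"] by (simp add: b_def c_def f_def algebra_simps)
  have 3: "2 * (real m + 1) * f = 2 * (real m + real l + 1) * a + (4 * real m + 2 * real l + 5) * e"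
    using boros_moll_Suc_left[of m l] by (simp add: a_def e_def f_def field_simps)
  \<comment> \<open>The factor \<open>2 * l * (l + 1)\<close> produces the left sides of 1 and 2
    verbatim, so rewriting removes \<open>e\<close> and \<open>f\<close>.\<close>
  have "2 * (real m + 1) * (2 * real l * (real l + 1) * f)
     = 2 * (real m + real l + 1) * a * (2 * real l * (real l + 1))
       + (4 * real m + 2 * real l + 5) * (2 * real l * (real l + 1) * e)"
    using 3 by algebra
  from this[unfolded 1 2]
  show ?thesis unfolding a_def[symmetric] b_def[symmetric] c_def[symmetric] by algebra
qed

section \<open>Positivity and the Kauers-Paule bound\<close>

lemma boros_moll_pos:
  assumes "l \<le> m"
  shows "boros_moll l m > 0"
proof -
  have "(\<Sum>k = l..m. 2 ^ k * real ((2 * m - 2 * k) choose (m - k))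
        * real ((m + k) choose k) * real (k choose l)) > 0"
    by (rule sum_pos) (use assms in \<open>auto simp: zero_less_binomial_iff\<close>)
  then show ?thesis by (simp add: boros_moll_def)
qed

lemma Kauers_Paule_bound:
  assumes "l \<ge> 1" "l \<le> m"
  shows "(4 * (real m)\<^sup>2 + 7 * real m + real l + 3) * boros_moll l m
     \<le> 2 * (real m + 1) * (real m + 1 - real l) * boros_moll l (m + 1)"
  using assms(2)
proof (induction m rule: dec_induct)
  case base
  \<comment> \<open>Equality holds at \<open>m = l\<close>: the upper neighbour vanishes and the
    bound factors as \<open>(2 * l + 1) * (2 * l + 3)\<close>.\<close>
  have "boros_moll (l + 1) l = 0" by (simp add: boros_moll_def)
  with boros_moll_upper_index[OF assms(1), of l] show ?case
    by (simp add: algebra_simps power2_eq_square)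
next
  case (step m)
  define x y where "x = real m" and "y = real l"
  define a b c where "a = boros_moll l m" and "b = boros_moll l (m + 1)" and "c = boros_moll l (m + 2)"
  have xy: "0 \<le> y" "y \<le> x" using step by (auto simp: x_def y_def)
  have a: "a > 0" using boros_moll_pos step by (simp add: a_def)
  define K where "K = 4 * x\<^sup>2 + 7 * x + y + 3"
  have IH: "K * a \<le> 2 * (x + 1) * (x + 1 - y) * b"
    using step.IH by (simp add: K_def x_def y_def a_def b_def)
  have rec: "4 * (x + 2 - y) * (x + 1) * (x + 2) * c
     = 2 * (x + 1) * (8 * x\<^sup>2 + 24 * x + 19 - 4 * y\<^sup>2) * b - (x + y + 1) * (4 * x + 3) * (4 * x + 5) * a"
    using boros_moll_three_term[OF assms(1), of m] by (simp add: x_def y_def a_def b_def c_def)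
  \<comment> \<open>The weight is the cofactor of \<open>x + 1 - y\<close> in the difference between
    \<open>8 * x^2 + 24 * x + 19 - 4 * y^2\<close> and the next bound
    \<open>4 * x^2 + 15 * x + y + 14\<close>. Weighted this way, the induction hypothesis dominates
    the \<open>a\<close> term of the recurrence.\<close>
  have "(4 * x + 4 * y + 5) * K = (x + y + 1) * (4 * x + 3) * (4 * x + 5) + y * (4 * y + 2)"
    unfolding K_def by algebra
  then have "(x + y + 1) * (4 * x + 3) * (4 * x + 5) * a \<le> (4 * x + 4 * y + 5) * K * a"
    using xy a by (intro mult_right_mono) auto
  also have "\<dots> \<le> (4 * x + 4 * y + 5) * (2 * (x + 1) * (x + 1 - y) * b)"
    using mult_left_mono[OF IH, of "4 * x + 4 * y + 5"] xy by (simp add: mult.assoc)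
  also have "\<dots> = 2 * (x + 1) * (8 * x\<^sup>2 + 24 * x + 19 - 4 * y\<^sup>2) * b
      - 2 * (x + 1) * ((4 * x\<^sup>2 + 15 * x + y + 14) * b)"
    by algebra
  finally have "2 * (x + 1) * ((4 * x\<^sup>2 + 15 * x + y + 14) * b)
      \<le> 2 * (x + 1) * (2 * (x + 2) * (x + 2 - y) * c)"
    using rec by (simp add: algebra_simps)
  then have "(4 * x\<^sup>2 + 15 * x + y + 14) * b \<le> 2 * (x + 2) * (x + 2 - y) * c"
    using xy by (subst (asm) mult_le_cancel_left_pos) auto
  then show ?case
    by (simp add: x_def y_def b_def c_def power2_eq_square algebra_simps)
qed

section \<open>Polynomial inequalities above the Kauers-Paule bound\<close>

lemma lower_quadratic_bound:
  fixes x y U :: real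
  assumes y: "1 \<le> y" and xy: "y < x" and U: "4 * x\<^sup>2 + 7 * x + y + 3 \<le> U"
  shows "x * (8 * x\<^sup>2 + 8 * x + 3 - 4 * y\<^sup>2 - U) * U
    < (x + 1) * (x + 1 - y) * (x + y) * (16 * x\<^sup>2 - 1)"
proof -
  define K w where "K = 4 * x\<^sup>2 + 7 * x + y + 3" and "w = U - K"
  have w: "w \<ge> 0" using U by (simp add: w_def K_def)
  \<comment> \<open>Expansion around \<open>U = K\<close>, where the first factor becomes
    \<open>(x - y) * (4 * x + 4 * y + 1)\<close>. The correction is nonpositive for
    \<open>w >= 0\<close>, so only \<open>U = K\<close> remains to be checked.\<close>
  have "x * (8 * x\<^sup>2 + 8 * x + 3 - 4 * y\<^sup>2 - U) * U
      = x * (x - y) * (4 * x + 4 * y + 1) * K - x * w * (6 * x + 3 + 2 * y + 4 * y\<^sup>2 + w)"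
    unfolding w_def K_def by algebra
  also have "\<dots> \<le> x * (x - y) * (4 * x + 4 * y + 1) * K"
    using w y xy by simp
  finally have 1: "x * (8 * x\<^sup>2 + 8 * x + 3 - 4 * y\<^sup>2 - U) * U \<le> \<dots>" .
  \<comment> \<open>The gap at \<open>U = K\<close>, arranged so that every summand is visibly
    nonnegative when \<open>1 <= y < x\<close>.\<close>
  have 2: "(x + 1) * (x + 1 - y) * (x + y) * (16 * x\<^sup>2 - 1) - x * (x - y) * (4 * x + 4 * y + 1) * K
     = 12 * x^3 * y + 15 * x\<^sup>2 * y + (x + 1) * (4 * x\<^sup>2 * (y - 1) + x * (y - 1) + y * (x - 1)
         + 12 * x * y\<^sup>2 + x * y + y\<^sup>2) + x * y\<^sup>2 * (4 * y + 1)"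
    unfolding K_def by algebra
  have "\<dots> > 0"
    using y xy by (intro add_pos_nonneg add_nonneg_nonneg mult_nonneg_nonneg mult_pos_pos) auto
  with 1 2 show ?thesis by linarith
qed

text \<open>As a polynomial in \<open>w = U - K\<close>, right side minus left side has positive
  constant term and nonnegative linear and quadratic coefficients.\<close>

lemma upper_quadratic_bound:
  fixes x y U :: real
  assumes y: "1 \<le> y" and xy: "y < x" and U: "4 * x\<^sup>2 + 7 * x + y + 3 \<le> U"
  shows "(x + 1) * (16 * x\<^sup>2 - 1) * (U - (4 * x + 2 * y + 3) * (x + 1 - y))
      * ((4 * x - 2 * y + 3) * (x + y + 1) - U)
    < 4 * x * y * (y + 1) * (8 * x\<^sup>2 + 8 * x + 3 - 4 * y\<^sup>2 - U) * U"
proof -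
  define D where "D = (x + 1) * (16 * x\<^sup>2 - 1)"
  define E where "E = 4 * x * y * (y + 1)"
  define K w where "K = 4 * x\<^sup>2 + 7 * x + y + 3" and "w = U - K"
  have w: "w \<ge> 0" using U by (simp add: w_def K_def)
  \<comment> \<open>This simpler lower bound for \<open>D\<close> serves both the quadratic and the
    linear coefficient.\<close>
  have "D - 15 * x\<^sup>2 * (x + 1) = (x + 1) * (x\<^sup>2 - 1)"
    unfolding D_def by algebra
  also have "\<dots> \<ge> 0"
    using y xy by (intro mult_nonneg_nonneg) auto
  finally have D: "15 * x\<^sup>2 * (x + 1) \<le> D" by simp
  have "y * (y + 1) \<le> x * (x + 1)"
    using y xy by (intro mult_mono) auto
  then have "E \<le> 4 * x * (x * (x + 1))"
    using y xy mult_left_mono[of "y * (y + 1)" "x * (x + 1)" "4 * x"] by (simp add: E_def mult.assoc)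
  also have "\<dots> \<le> 15 * x\<^sup>2 * (x + 1)"
    using y xy by (simp add: power2_eq_square)
  also note D
  finally have DE: "E \<le> D" .
  \<comment> \<open>At \<open>U = K\<close> the two differences multiplied by \<open>D\<close> equal
    \<open>2 * y * (x + y + 1)\<close> and \<open>2 * y * (x - y)\<close>, which explains the common
    factor \<open>4 * y * (x - y)\<close> of the constant term.\<close>
  have expand: "E * (8 * x\<^sup>2 + 8 * x + 3 - 4 * y\<^sup>2 - U) * U
      - D * (U - (4 * x + 2 * y + 3) * (x + 1 - y)) * ((4 * x - 2 * y + 3) * (x + y + 1) - U)
    = 4 * y * (x - y) * (x * (y + 1) * (4 * x + 4 * y + 1) * K - y * D * (x + y + 1))
      + (D - E) * w\<^sup>2 + w * (2 * y * (2 * y + 1) * D - E * (6 * x + 3 + 2 * y + 4 * y\<^sup>2))"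
    unfolding D_def E_def K_def w_def by algebra
  have "x * (y + 1) * (4 * x + 4 * y + 1) * K - y * D * (x + y + 1)
      = x * (4 * x + 4 * y + 1) * (y * (y + 1) + (x + 1) * (4 * x + 3))
        + y * (x + 1) * (12 * x * y + 4 * x + y + 1)"
    unfolding D_def K_def by algebra
  also have "\<dots> > 0"
    using y xy by (intro add_pos_nonneg add_nonneg_nonneg mult_nonneg_nonneg mult_pos_pos) auto
  finally have const: "4 * y * (x - y) * (x * (y + 1) * (4 * x + 4 * y + 1) * K - y * D * (x + y + 1)) > 0"
    using y xy by simp
  have linear: "2 * y * (2 * y + 1) * D - E * (6 * x + 3 + 2 * y + 4 * y\<^sup>2) \<ge> 0"
  proof -
    have "y\<^sup>2 \<le> x\<^sup>2" "y \<le> x\<^sup>2" "1 \<le> x\<^sup>2"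
      using y xy power_mono[of y x 2] self_le_power[of x 2] by auto
    then have "2 * (6 * x + 3 + 2 * y + 4 * y\<^sup>2) \<le> 15 * x * (x + 1)"
      using y xy by (simp add: power2_eq_square algebra_simps)
    then have "2 * x * (2 * (6 * x + 3 + 2 * y + 4 * y\<^sup>2)) \<le> 2 * x * (15 * x * (x + 1))"
      using y xy by (intro mult_left_mono) auto
    then have "4 * x * (6 * x + 3 + 2 * y + 4 * y\<^sup>2) \<le> 2 * x * (15 * x * (x + 1))"
      by (simp add: algebra_simps)
    also have "\<dots> = 2 * (15 * x\<^sup>2 * (x + 1))"
      by algebra
    finally have "4 * x * (6 * x + 3 + 2 * y + 4 * y\<^sup>2) \<le> 2 * D"
      using D by linarith
    then have "y * (y + 1) * (4 * x * (6 * x + 3 + 2 * y + 4 * y\<^sup>2)) \<le> y * (y + 1) * (2 * D)"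
      using y by (intro mult_left_mono) auto
    also have "\<dots> \<le> y * (2 * y + 1) * (2 * D)"
      using y xy D by (intro mult_right_mono mult_left_mono) (auto intro: order_trans[OF _ D])
    finally show ?thesis by (simp add: E_def algebra_simps)
  qed
  have "(D - E) * w\<^sup>2 \<ge> 0" using DE by simp
  with const mult_nonneg_nonneg[OF w linear]
  have "D * (U - (4 * x + 2 * y + 3) * (x + 1 - y)) * ((4 * x - 2 * y + 3) * (x + y + 1) - U)
      < E * (8 * x\<^sup>2 + 8 * x + 3 - 4 * y\<^sup>2 - U) * U"
    using expand by linarith
  then show ?thesis by (simp only: D_def E_def)
qed

section \<open>Reduction of the products to the quadratic inequalities\<close>

theorem proposition3p4:
  fixes l m :: nat
  assumes "l \<ge> 1" and "m \<ge> l + 1"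
  shows "(boros_moll l m)\<^sup>2 > boros_moll l (m - 1) * boros_moll l (m + 1)
       \<and> boros_moll l (m - 1) * boros_moll l (m + 1) > boros_moll (l - 1) m * boros_moll (l + 1) m"
proof -
  obtain n where m: "m = n + 1" using assms by (metis add.commute le_Suc_ex le_add2 le_trans)
  define x y where "x = real m" and "y = real l"
  define a b c where "a = boros_moll l (m - 1)" and "b = boros_moll l m" and "c = boros_moll l (m + 1)"
  define e f where "e = boros_moll (l - 1) m" and "f = boros_moll (l + 1) m"
  define U where "U = 2 * (x + 1) * (x + 1 - y) * c / b"
  have y: "1 \<le> y" and xy: "y < x" using assms by (auto simp: x_def y_def)
  have x2: "16 * x\<^sup>2 - 1 > 0" using y xy one_le_power[of x 2] by linarith
  have b: "b > 0" using boros_moll_pos assms by (simp add: b_def)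
  have c: "2 * (x + 1) * (x + 1 - y) * c = U * b" using b by (simp add: U_def)
  have "(4 * x\<^sup>2 + 7 * x + y + 3) * b \<le> U * b"
    using Kauers_Paule_bound[of l m] assms unfolding c[symmetric]
    by (simp add: x_def y_def b_def c_def)
  then have U: "4 * x\<^sup>2 + 7 * x + y + 3 \<le> U" using b by simp
  \<comment> \<open>The recurrence in \<open>m\<close>, taken at \<open>n = m - 1\<close>, ties
    \<open>a\<close> to \<open>b\<close> and \<open>c\<close>.\<close>
  have "4 * (x + 1 - y) * x * (x + 1) * c
     = 2 * x * (8 * x\<^sup>2 + 8 * x + 3 - 4 * y\<^sup>2) * b - (x + y) * (4 * x - 1) * (4 * x + 1) * a"
    using boros_moll_three_term[of l n] assms
    by (simp add: x_def y_def a_def b_def c_def m power2_eq_square algebra_simps)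
  with c have a: "(x + y) * (16 * x\<^sup>2 - 1) * a = 2 * x * (8 * x\<^sup>2 + 8 * x + 3 - 4 * y\<^sup>2 - U) * b"
    by algebra
  have "2 * (x + y) * e = 2 * (x + 1) * c - (4 * x + 2 * y + 3) * b"
    using boros_moll_lower_index[of l m] assms by (simp add: x_def y_def b_def c_def e_def)
  with c have e: "2 * (x + y) * (x + 1 - y) * e = (U - (4 * x + 2 * y + 3) * (x + 1 - y)) * b"
    by algebra
  have "2 * y * (y + 1) * f = (4 * x - 2 * y + 3) * (x + y + 1) * b - 2 * (x + 1) * (x + 1 - y) * c"
    using boros_moll_upper_index[of l m] assms by (simp add: x_def y_def b_def c_def f_def)
  with c have f: "2 * y * (y + 1) * f = ((4 * x - 2 * y + 3) * (x + y + 1) - U) * b"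
    by algebra
  \<comment> \<open>Half the product of the factors multiplying \<open>a\<close> and
    \<open>c\<close> in their formulas; \<open>4 * y * (y + 1) * M\<close> likewise clears the
    denominators of \<open>e * f\<close>. Both products thus become multiples of
    \<open>b^2\<close>.\<close>
  define M where "M = (x + 1) * (x + 1 - y) * (x + y) * (16 * x\<^sup>2 - 1)"
  have M: "M > 0" using x2 y xy by (simp add: M_def)
  have ac: "M * (a * c) = x * (8 * x\<^sup>2 + 8 * x + 3 - 4 * y\<^sup>2 - U) * U * b\<^sup>2"
    using a c unfolding M_def by algebra
  also have "\<dots> < M * b\<^sup>2"
    using lower_quadratic_bound[OF y xy U] b unfolding M_def by (intro mult_strict_right_mono) auto
  finally have 1: "a * c < b\<^sup>2" using M by simp
  have "4 * y * (y + 1) * M * (e * f) = (x + 1) * (16 * x\<^sup>2 - 1)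
      * (U - (4 * x + 2 * y + 3) * (x + 1 - y)) * ((4 * x - 2 * y + 3) * (x + y + 1) - U) * b\<^sup>2"
    using e f unfolding M_def by algebra
  also have "\<dots> < 4 * x * y * (y + 1) * (8 * x\<^sup>2 + 8 * x + 3 - 4 * y\<^sup>2 - U) * U * b\<^sup>2"
    using upper_quadratic_bound[OF y xy U] b by (intro mult_strict_right_mono) auto
  also have "\<dots> = 4 * y * (y + 1) * M * (a * c)"
    using ac by algebra
  finally have 2: "e * f < a * c" using M y by simp
  from 1 2 show ?thesis by (simp add: a_def b_def c_def e_def f_def)
qed

end
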